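(* For every integer $n\geqslant 6$, the number of partitions of $n$ with no parts equal to $1$, at most one part equal to $2$, and the largest part occurring more than once equals $\nabla^2[p](n)-\nabla^2[p](n-4)$, and $$\nabla^2 [p](n)-\nabla^2 [p](n-4)=-\sum_{k=5}^{n+5} S^{(5)}_{n+5,k}\, \mu(k).$$
   Context: $p(m)$ denotes the number of partitions of the non-negative integer $m$ (with $p(0)=1$). The $N$th order backward difference of a function $f$ is $\nabla^N[f](x)=\sum_{k=0}^N(-1)^k\binom{N}{k}f(x-k)$, so $\nabla^2[p](m)=p(m)-2p(m-1)+p(m-2)$. $\mu$ is the classical Möbius function on positive integers: $\mu(m)=0$ if $m$ is divisible by the square of a prime, and $\mu(m)=(-1)^s$ if $m$ is a product of $s\geqslant 0$ distinct primes. For integers $r\geqslant 1$, $k\geqslant 1$, $m\geqslant 0$, $S^{(r)}_{m,k}$ denotes the number of $k$'s in the partitions of $m$ with smallest part at least $r$, i.e. the total number of occurrences (with multiplicity) of the part $k$ summed over all partitions of $m$ all of whose parts are $\geqslant r$. *)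

theory Defs
  imports
    "HOL-Computational_Algebra.Primes"
    "HOL-Library.Multiset"
begin

text \<open>
  A partition of \<open>n\<close> is the finite multiset of its (positive) parts.
\<close>

definition partitions :: "nat \<Rightarrow> nat multiset set" where
  "partitions n = {M. 0 \<notin># M \<and> sum_mset M = n}"

text \<open>
  Finiteness guarantees that the uses of \<^const>\<open>card\<close> and \<^const>\<open>sum\<close> over sets of
  partitions below do not fall back on their default value for infinite sets.
\<close>

lemma finite_partitions: "finite (partitions n)"
proof (rule finite_subset)
  show "partitions n \<subseteq> mset ` {xs. set xs \<subseteq> {..n} \<and> length xs \<le> n}"
  proof
    fix M assume "M \<in> partitions n"
    then have pos: "0 \<notin># M" and sm: "sum_mset M = n"
      by (auto simp: partitions_def)
    obtain xs where xs: "M = mset xs"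
      using ex_mset by metis
    have "sum_list xs = n"
      using sm xs by (simp add: sum_mset_sum_list)
    moreover have "length xs \<le> sum_list xs" if "0 \<notin> set xs" for xs :: "nat list"
      using that by (induction xs) auto
    moreover have "0 \<notin> set xs"
      using pos xs by simp
    moreover have "set xs \<subseteq> {..sum_list xs}"
      using member_le_sum_list by blast
    ultimately show "M \<in> mset ` {xs. set xs \<subseteq> {..n} \<and> length xs \<le> n}"
      using xs by auto
  qed
  show "finite (mset ` {xs. set xs \<subseteq> {..n} \<and> length xs \<le> n})"
    by (intro finite_imageI finite_lists_length_le) simp
qed

definition partition_count :: "nat \<Rightarrow> nat" where
  "partition_count n = card (partitions n)"

text \<open>
  The argument is a natural number, so \<open>x - k\<close> is truncated: this is the \<open>N\<close>-th order
  backward difference of \<open>f\<close> only for \<open>x \<ge> N\<close>.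
\<close>

definition backward_difference :: "nat \<Rightarrow> (nat \<Rightarrow> int) \<Rightarrow> nat \<Rightarrow> int" where
  "backward_difference N f x = (\<Sum>k=0..N. (- 1) ^ k * int (N choose k) * f (x - k))"

definition moebius :: "nat \<Rightarrow> int" where
  "moebius m =
    (if \<exists>p. prime p \<and> p\<^sup>2 dvd m then 0 else (- 1) ^ card (prime_factors m))"

definition part_occurrences :: "nat \<Rightarrow> nat \<Rightarrow> nat \<Rightarrow> nat" where
  "part_occurrences r m k = (\<Sum>M \<in> {M \<in> partitions m. \<forall>j \<in># M. r \<le> j}. count M k)"

end

theory Submission
  imports Defs "HOL-Computational_Algebra.Formal_Power_Series"
begin

text \<open>
  All three quantities are the coefficient of \<open>X^n\<close> in \<open>(1 - X)\<^sup>2 (1 - X^4) P(X)\<close>, where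
  \<open>P\<close> is the generating function of the partition numbers. Partitions without 1 and with at
  most one 2 have generating function \<open>(1 - X) (1 - X^4) P\<close>, and decrementing a largest part
  that occurs only once maps those of \<open>n\<close> bijectively to those of \<open>n - 1\<close>. On the other side,
  the occurrences of \<open>k\<close> have generating function \<open>X^k / (1 - X^k)\<close> times that of the partitions
  into parts at least 5. As the sum of \<open>\<mu>(k) X^k / (1 - X^k)\<close> over all \<open>k \<ge> 1\<close> is \<open>X\<close>, the sum over
  \<open>k \<ge> 5\<close> is the rational function \<open>X - X / (1 - X) + X^2 / (1 - X^2) + X^3 / (1 - X^3)\<close>.
\<close>

unbundle fps_syntax

section \<open>Partitions with parts in a prescribed set and their generating functions\<close>

definition parts_in :: "nat set \<Rightarrow> nat \<Rightarrow> nat multiset set" where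
  "parts_in A n = {M \<in> partitions n. set_mset M \<subseteq> A}"

definition parts_fps :: "nat set \<Rightarrow> int fps" where
  "parts_fps A = Abs_fps (\<lambda>n. int (card (parts_in A n)))"

text \<open>For \<open>k > 0\<close> this is the expansion of X^k / (1 - X^k). The condition
  \<open>0 < i\<close> removes the constant term, since \<open>k\<close> divides 0.\<close>

definition multiples_fps :: "nat \<Rightarrow> int fps" where
  "multiples_fps k = Abs_fps (\<lambda>i. if 0 < i \<and> k dvd i then 1 else 0)"

lemma finite_parts_in [simp]: "finite (parts_in A n)"
  by (auto simp: parts_in_def intro: finite_subset[OF _ finite_partitions[of n]])

lemma parts_in_positive: "parts_in {1..} n = partitions n"
  by (force simp: parts_in_def partitions_def Suc_le_eq intro: gr0I)

lemma partition_count_eq_parts_fps: "int (partition_count n) = parts_fps {1..} $ n"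
  by (simp only: partition_count_def parts_fps_def parts_in_positive fps_nth_Abs_fps)

lemma count_mult_le_sum_mset: "count M k * k \<le> sum_mset M" for M :: "nat multiset"
  by (induction M) auto

text \<open>Deleting \<open>j\<close> copies of \<open>k\<close> is undone by adding them back,
  which stays within \<open>A\<close> because \<open>k\<close> is in \<open>A\<close>. The case
  \<open>j * k > n\<close> is split off because the truncated \<open>n - j * k\<close> would be 0
  and the empty partition would be counted.\<close>

lemma card_parts_in_count_ge:
  assumes "k \<in> A" "0 < k"
  shows "card {M \<in> parts_in A n. j \<le> count M k} =
    (if j * k \<le> n then card (parts_in A (n - j * k)) else 0)"
proof (cases "j * k \<le> n")
  case True
  have "bij_betw (\<lambda>M. M + replicate_mset j k) (parts_in A (n - j * k))
          {M \<in> parts_in A n. j \<le> count M k}"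
  proof (rule bij_betwI[where g = "\<lambda>M. M - replicate_mset j k"])
    show "(\<lambda>M. M + replicate_mset j k) \<in> parts_in A (n - j * k) \<rightarrow>
        {M \<in> parts_in A n. j \<le> count M k}"
      using assms True by (auto simp: parts_in_def partitions_def split: if_splits)
    show "(\<lambda>M. M - replicate_mset j k) \<in> {M \<in> parts_in A n. j \<le> count M k} \<rightarrow>
        parts_in A (n - j * k)"
      by (auto simp: parts_in_def partitions_def sum_mset_diff simp flip: count_le_replicate_mset_subset_eq
               dest!: in_diffD)
    show "M - replicate_mset j k + replicate_mset j k = M"
      if "M \<in> {M \<in> parts_in A n. j \<le> count M k}" for M
      using that by (simp add: count_le_replicate_mset_subset_eq)
  qed simp
  then show ?thesis
    using True by (simp add: bij_betw_same_card)
next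
  case False
  have "n < count M k * k" if "j \<le> count M k" for M
    using False mult_le_mono1[OF that, of k] by linarith
  then have "{M \<in> parts_in A n. j \<le> count M k} = {}"
    using count_mult_le_sum_mset[of _ k]
    by (auto simp: parts_in_def partitions_def not_le[symmetric])
  then show ?thesis
    using False by simp
qed

text \<open>Complement of the previous count. Taking \<open>j = 1\<close> forbids the part
  \<open>k\<close>; taking \<open>j = 2\<close> allows it at most once.\<close>

lemma card_parts_in_count_less:
  assumes "k \<in> A" "0 < k"
  shows "int (card {M \<in> parts_in A n. count M k < j}) = ((1 - fps_X ^ (j * k)) * parts_fps A) $ n"
proof -
  let ?L = "{M \<in> parts_in A n. count M k < j}" and ?G = "{M \<in> parts_in A n. j \<le> count M k}"
  have "card (parts_in A n) = card (?L \<union> ?G)"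
    by (rule arg_cong[where f = card]) auto
  also have "\<dots> = card ?L + card ?G"
    by (rule card_Un_disjoint) auto
  finally show ?thesis
    using card_parts_in_count_ge[OF assms, of n j]
    by (auto simp: parts_fps_def algebra_simps fps_X_power_mult_nth)
qed

lemma parts_fps_remove:
  assumes "k \<in> A" "0 < k"
  shows "parts_fps (A - {k}) = (1 - fps_X ^ k) * parts_fps A"
proof (rule fps_ext)
  fix n
  have "parts_in (A - {k}) n = {M \<in> parts_in A n. count M k < 1}"
    by (auto simp: parts_in_def simp flip: not_in_iff)
  then show "parts_fps (A - {k}) $ n = ((1 - fps_X ^ k) * parts_fps A) $ n"
    using card_parts_in_count_less[OF assms, of n 1] by (simp add: parts_fps_def)
qed

lemma parts_fps_atLeast_Suc:
  assumes "0 < k"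
  shows "parts_fps {Suc k..} = (1 - fps_X ^ k) * parts_fps {k..}"
proof -
  have "{Suc k..} = {k..} - {k}"
    by auto
  then show ?thesis
    using parts_fps_remove[of k "{k..}"] assms by simp
qed

lemma one_minus_X_power_mult_multiples_fps:
  assumes "0 < k"
  shows "(1 - fps_X ^ k) * multiples_fps k = fps_X ^ k"
proof (rule fps_ext)
  fix i
  have "k dvd i - k \<longleftrightarrow> k dvd i" if "k \<le> i"
    using that by (simp add: dvd_minus_self)
  moreover have "\<not> k dvd i" if "i < k" "0 < i"
    using that by (auto dest: dvd_imp_le)
  ultimately show "((1 - fps_X ^ k) * multiples_fps k) $ i = fps_X ^ k $ i"
    using assms
    by (auto simp: multiples_fps_def algebra_simps fps_X_power_mult_nth fps_X_power_nth)
qed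

text \<open>A multiplicity is the number of \<open>j\<close> from 1 up to it, so the occurrences of
  \<open>k\<close> are counted by summing, over \<open>j >= 1\<close>, the partitions with at least
  \<open>j\<close> copies of \<open>k\<close>, that is, the partitions of
  \<open>n - j * k\<close>.\<close>

lemma part_occurrences_eq_fps:
  assumes "r \<le> k" "0 < k"
  shows "int (part_occurrences r n k) = (multiples_fps k * parts_fps {r..}) $ n"
proof -
  \<comment> \<open>The threshold \<open>j\<close> is indexed by its multiple
    \<open>i = j * k\<close>, so that exchanging the sums yields a Cauchy product directly.\<close>
  have count: "count M k = (\<Sum>i=0..n. if 0 < i \<and> k dvd i \<and> i div k \<le> count M k then 1 else 0)"
    if "M \<in> parts_in {r..} n" for M
  proof -
    have "count M k * k \<le> n"
      using that count_mult_le_sum_mset[of M k] by (simp add: parts_in_def partitions_def)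
    then have "{i \<in> {0..n}. 0 < i \<and> k dvd i \<and> i div k \<le> count M k} = (\<lambda>j. j * k) ` {1..count M k}"
      (is "?I = ?J")
    proof (intro equalityI subsetI)
      fix i assume "i \<in> ?I"
      then have "i = i div k * k" "i div k \<in> {1..count M k}"
        using assms by (auto simp: Suc_le_eq div_greater_zero_iff dvd_imp_le)
      then show "i \<in> ?J"
        by (rule image_eqI)
    next
      fix i assume "i \<in> ?J"
      then obtain j where j: "i = j * k" "j \<in> {1..count M k}"
        by blast
      then have "j * k \<le> count M k * k"
        by (intro mult_le_mono1) simp
      then have "j * k \<le> n"
        using \<open>count M k * k \<le> n\<close> by (rule order_trans)
      with j assms show "i \<in> ?I"
        by auto
    qed
    moreover have "inj_on (\<lambda>j. j * k) {1..count M k}"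
      using assms by (auto simp: inj_on_def)
    ultimately have "card {i \<in> {0..n}. 0 < i \<and> k dvd i \<and> i div k \<le> count M k} = count M k"
      by (simp add: card_image)
    then show ?thesis
      by (simp flip: sum.inter_filter)
  qed
  have "part_occurrences r n k = (\<Sum>M\<in>parts_in {r..} n. count M k)"
    unfolding part_occurrences_def parts_in_def by (rule sum.cong) auto
  also have "\<dots> = (\<Sum>M\<in>parts_in {r..} n. \<Sum>i=0..n.
      if 0 < i \<and> k dvd i \<and> i div k \<le> count M k then 1 else 0)"
    using count by (rule sum.cong[OF refl])
  also have "\<dots> = (\<Sum>i=0..n. \<Sum>M\<in>parts_in {r..} n.
      if 0 < i \<and> k dvd i \<and> i div k \<le> count M k then 1 else 0)"
    by (rule sum.swap)
  also have "\<dots> = (\<Sum>i=0..n. if 0 < i \<and> k dvd i then card (parts_in {r..} (n - i)) else 0)"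
  proof (rule sum.cong)
    fix i assume i: "i \<in> {0..n}"
    show "(\<Sum>M\<in>parts_in {r..} n. if 0 < i \<and> k dvd i \<and> i div k \<le> count M k then 1 else 0) =
        (if 0 < i \<and> k dvd i then card (parts_in {r..} (n - i)) else 0)"
    proof (cases "0 < i \<and> k dvd i")
      case True
      then show ?thesis
        using i assms card_parts_in_count_ge[of k "{r..}" n "i div k"]
        by (simp flip: sum.inter_filter)
    next
      case False
      then show ?thesis by auto
    qed
  qed simp
  finally have "int (part_occurrences r n k) =
      (\<Sum>i=0..n. int (if 0 < i \<and> k dvd i then card (parts_in {r..} (n - i)) else 0))"
    by simp
  also have "\<dots> = (multiples_fps k * parts_fps {r..}) $ n"
    unfolding fps_mult_nth by (rule sum.cong) (auto simp: multiples_fps_def parts_fps_def)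
  finally show ?thesis .
qed

section \<open>Moebius divisor sums and the weighted sum of occurrences\<close>

lemma moebius_eq_0: "prime p \<Longrightarrow> p\<^sup>2 dvd m \<Longrightarrow> moebius m = 0"
  by (auto simp: moebius_def)

lemma moebius_one: "moebius 1 = 1"
  by (auto simp: moebius_def)

text \<open>The new prime adds one prime factor and, as it does not divide \<open>k\<close>, creates
  no new square of a prime among the divisors.\<close>

lemma moebius_prime_mult:
  assumes p: "prime p" and k: "\<not> p dvd k"
  shows "moebius (p * k) = - moebius k"
proof -
  have "k \<noteq> 0"
    using k by (cases "k = 0") auto
  have sq: "q\<^sup>2 dvd p * k \<longleftrightarrow> q\<^sup>2 dvd k" if q: "prime q" for q
  proof (cases "q = p")
    case True
    have "\<not> p\<^sup>2 dvd p * k"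
      using p k by (simp add: power2_eq_square prime_gt_0_nat)
    moreover have "\<not> p\<^sup>2 dvd k"
      using k by (metis dvd_trans dvd_triv_left power2_eq_square)
    ultimately show ?thesis
      using True by simp
  next
    case False
    then have "coprime (q\<^sup>2) p"
      using p q by (simp add: primes_coprime)
    then show ?thesis
      by (simp add: coprime_dvd_mult_right_iff)
  qed
  have "prime_factors (p * k) = insert p (prime_factors k)"
    using p \<open>k \<noteq> 0\<close> by (simp add: prime_factors_product prime_prime_factors)
  moreover have "p \<notin> prime_factors k"
    using k by auto
  ultimately have "card (prime_factors (p * k)) = Suc (card (prime_factors k))"
    by simp
  then show ?thesis
    using sq unfolding moebius_def by auto
qed

text \<open>For \<open>d > 1\<close> fix a prime \<open>p\<close> dividing \<open>d\<close>. A
  divisor \<open>k\<close> prime to \<open>p\<close> cancels against \<open>p * k\<close>; the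
  remaining divisors are multiples of \<open>p\<^sup>2\<close> and contribute 0.\<close>

lemma sum_moebius_divisors:
  assumes "0 < d"
  shows "(\<Sum>k | k dvd d. moebius k) = (if d = 1 then 1 else 0)"
proof (cases "d = 1")
  case True
  then show ?thesis
    by (simp add: moebius_one[simplified])
next
  case False
  then obtain p where p: "prime p" "p dvd d"
    using prime_factor_nat by blast
  let ?D = "{k. k dvd d \<and> \<not> p dvd k}" and ?E = "{k. k dvd d \<and> p dvd k}"
  have fin: "finite {k. k dvd d}"
    using assms by simp
  have "(\<Sum>k\<in>?E. moebius k) = (\<Sum>k\<in>(*) p ` ?D. moebius k)"
  proof (rule sum.mono_neutral_right)
    show "finite ?E"
      using fin by (rule rev_finite_subset) auto
    have "p * k dvd d" if "k dvd d" "\<not> p dvd k" for k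
      using that p by (simp add: divides_mult prime_imp_coprime)
    then show "(*) p ` ?D \<subseteq> ?E"
      by auto
    show "\<forall>k\<in>?E - (*) p ` ?D. moebius k = 0"
    proof
      fix k assume k: "k \<in> ?E - (*) p ` ?D"
      then obtain l where l: "k = p * l"
        by (auto elim: dvdE)
      with k have "p dvd l"
        by (auto dest: dvd_mult_right)
      with l p show "moebius k = 0"
        by (intro moebius_eq_0[of p]) (simp_all add: power2_eq_square)
    qed
  qed
  also have "\<dots> = (\<Sum>k\<in>?D. moebius (p * k))"
    using p by (subst sum.reindex) (auto simp: inj_on_def)
  also have "\<dots> = (\<Sum>k\<in>?D. - moebius k)"
    using p by (intro sum.cong) (auto simp: moebius_prime_mult)
  finally have "(\<Sum>k\<in>?E. moebius k) = - (\<Sum>k\<in>?D. moebius k)"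
    by (simp add: sum_negf)
  moreover have "(\<Sum>k | k dvd d. moebius k) = (\<Sum>k\<in>?D \<union> ?E. moebius k)"
    by (rule sum.cong) auto
  moreover have "\<dots> = (\<Sum>k\<in>?D. moebius k) + (\<Sum>k\<in>?E. moebius k)"
    using fin by (intro sum.union_disjoint) (auto intro: finite_subset)
  ultimately show ?thesis
    using False by simp
qed

text \<open>Subtract the terms for \<open>k\<close> = 1, 2, 3, 4 from the full divisor sum; the
  Moebius values there are 1, -1, -1, 0. The bound \<open>i <= N\<close> guarantees that no divisor
  of \<open>i\<close> is lost.\<close>

lemma sum_moebius_divisors_ge_5:
  assumes "0 < i" "i \<le> N"
  shows "(\<Sum>k=5..N. if k dvd i then moebius k else 0) =
    (if i = 1 then 1 else 0) - 1 + (if 2 dvd i then 1 else 0) + (if 3 dvd i then 1 else 0)"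
proof -
  let ?f = "\<lambda>k. if k dvd i then moebius k else 0"
  have m2: "moebius 2 = - 1" and m3: "moebius 3 = - 1"
    using moebius_prime_mult[of 2 1] moebius_prime_mult[of 3 1] moebius_one by simp_all
  have m4: "moebius 4 = 0"
    using moebius_eq_0[of 2 4] by simp
  have "(\<Sum>k | k dvd i. moebius k) = (\<Sum>k\<in>{1..4} \<union> {5..N}. ?f k)"
  proof (rule sum.mono_neutral_cong_left)
    show "{k. k dvd i} \<subseteq> {1..4} \<union> {5..N}"
    proof
      fix k assume "k \<in> {k. k dvd i}"
      then have "0 < k" "k \<le> i"
        using assms(1) by (auto intro: dvd_imp_le dvd_pos_nat)
      then show "k \<in> {1..4} \<union> {5..N}"
        using assms(2) by auto
    qed
  qed auto
  also have "\<dots> = (\<Sum>k=1..4. ?f k) + (\<Sum>k=5..N. ?f k)"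
    by (rule sum.union_disjoint) auto
  also have "(\<Sum>k=1..4. ?f k) = 1 + (if 2 dvd i then - 1 else 0) + (if 3 dvd i then - 1 else 0)"
    using m2 m3 m4 moebius_one by (simp add: numeral_eq_Suc)
  finally show ?thesis
    using sum_moebius_divisors[OF assms(1)] by (auto split: if_splits)
qed

text \<open>Stopping at \<open>k = N\<close> is harmless: only coefficients with index
  \<open>i <= N\<close> enter, and no \<open>k > N\<close> divides a positive such
  \<open>i\<close>.\<close>

lemma sum_part_occurrences_moebius:
  "(\<Sum>k=5..N. int (part_occurrences 5 N k) * moebius k) =
    ((fps_X - multiples_fps 1 + multiples_fps 2 + multiples_fps 3) * parts_fps {5..}) $ N"
  (is "_ = (?C * ?F) $ N")
proof -
  have "(\<Sum>k=5..N. int (part_occurrences 5 N k) * moebius k) =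
      (\<Sum>k=5..N. \<Sum>i=0..N. multiples_fps k $ i * ?F $ (N - i) * moebius k)"
    by (intro sum.cong) (simp_all add: part_occurrences_eq_fps fps_mult_nth sum_distrib_right)
  also have "\<dots> = (\<Sum>i=0..N. \<Sum>k=5..N. multiples_fps k $ i * ?F $ (N - i) * moebius k)"
    by (rule sum.swap)
  also have "\<dots> = (\<Sum>i=0..N. (\<Sum>k=5..N. multiples_fps k $ i * moebius k) * ?F $ (N - i))"
    by (simp add: sum_distrib_left sum_distrib_right mult_ac)
  also have "\<dots> = (\<Sum>i=0..N. ?C $ i * ?F $ (N - i))"
  proof (rule sum.cong)
    fix i assume i: "i \<in> {0..N}"
    have "(\<Sum>k=5..N. multiples_fps k $ i * moebius k) = ?C $ i"
    \<comment> \<open>Divisor sums are used only for positive \<open>i\<close>; at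
      \<open>i = 0\<close> both sides vanish, as \<open>multiples_fps\<close> has no constant
      term.\<close>
    proof (cases "i = 0")
      case False
      have "(\<Sum>k=5..N. multiples_fps k $ i * moebius k) =
          (\<Sum>k=5..N. if k dvd i then moebius k else 0)"
        using False by (intro sum.cong) (auto simp: multiples_fps_def)
      then show ?thesis
        using False i sum_moebius_divisors_ge_5[of i N]
        by (simp add: multiples_fps_def fps_X_def)
    qed (simp add: multiples_fps_def)
    then show "(\<Sum>k=5..N. multiples_fps k $ i * moebius k) * ?F $ (N - i) = ?C $ i * ?F $ (N - i)"
      by simp
  qed simp
  finally show ?thesis
    by (simp add: fps_mult_nth)
qed

text \<open>Excluding the parts 1, 2, 3 supplies exactly the factors that clear the three
  denominators. What remains is a polynomial identity with value -X^5 (1 - X)^2; its X^5 is the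
  origin of the shift from \<open>n\<close> to \<open>n + 5\<close>.\<close>

lemma multiples_fps_mult_parts_fps_5:
  "(fps_X - multiples_fps 1 + multiples_fps 2 + multiples_fps 3) * parts_fps {5..} =
    - (fps_X ^ 5 * ((1 - fps_X)\<^sup>2 * (1 - fps_X ^ 4) * parts_fps {1..}))"
proof -
  have 1: "(1 - fps_X) * multiples_fps 1 = fps_X"
    using one_minus_X_power_mult_multiples_fps[of 1] by simp
  have 2: "(1 - fps_X ^ 2) * multiples_fps 2 = fps_X ^ 2"
    using one_minus_X_power_mult_multiples_fps[of 2] by simp
  have 3: "(1 - fps_X ^ 3) * multiples_fps 3 = fps_X ^ 3"
    using one_minus_X_power_mult_multiples_fps[of 3] by simp
  have F: "parts_fps {5..} =
      (1 - fps_X ^ 4) * ((1 - fps_X ^ 3) * ((1 - fps_X ^ 2) * ((1 - fps_X) * parts_fps {1..})))"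
    using parts_fps_atLeast_Suc[of 4] parts_fps_atLeast_Suc[of 3]
      parts_fps_atLeast_Suc[of 2] parts_fps_atLeast_Suc[of 1] by (simp add: eval_nat_numeral)
  \<comment> \<open>Each series is grouped with its own denominator, ready to be replaced by X, X^2
    and X^3.\<close>
  have "(fps_X - multiples_fps 1 + multiples_fps 2 + multiples_fps 3) * parts_fps {5..} =
      (fps_X * ((1 - fps_X) * (1 - fps_X ^ 2) * (1 - fps_X ^ 3))
       - (1 - fps_X ^ 2) * (1 - fps_X ^ 3) * ((1 - fps_X) * multiples_fps 1)
       + (1 - fps_X) * (1 - fps_X ^ 3) * ((1 - fps_X ^ 2) * multiples_fps 2)
       + (1 - fps_X) * (1 - fps_X ^ 2) * ((1 - fps_X ^ 3) * multiples_fps 3))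
      * (1 - fps_X ^ 4) * parts_fps {1..}"
    unfolding F by algebra
  also have "\<dots> = - (fps_X ^ 5 * ((1 - fps_X)\<^sup>2 * (1 - fps_X ^ 4) * parts_fps {1..}))"
    unfolding 1 2 3 by algebra
  finally show ?thesis .
qed

section \<open>Partitions without 1 and with at most one 2\<close>

definition few_twos :: "nat \<Rightarrow> nat multiset set" where
  "few_twos n = {M \<in> parts_in {2..} n. count M 2 < 2}"

lemma few_twos_eq: "few_twos n = {M \<in> partitions n. 1 \<notin># M \<and> count M 2 \<le> 1}"
proof -
  have "set_mset M \<subseteq> {2..} \<longleftrightarrow> 1 \<notin># M" if "0 \<notin># M" for M :: "nat multiset"
  proof
    assume "1 \<notin># M"
    show "set_mset M \<subseteq> {2..}"
    proof
      fix x assume "x \<in># M"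
      then have "x \<noteq> 0" "x \<noteq> 1"
        using that \<open>1 \<notin># M\<close> by metis+
      then show "x \<in> {2..}"
        by simp
    qed
  qed auto
  then show ?thesis
    by (auto simp: few_twos_def parts_in_def partitions_def)
qed

text \<open>Forbidding 1 gives the factor 1 - X; allowing fewer than two copies of 2 gives 1 -
  X^(2*2).\<close>

lemma card_few_twos:
  "int (card (few_twos n)) = ((1 - fps_X) * (1 - fps_X ^ 4) * parts_fps {1..}) $ n"
proof -
  have "parts_fps {2..} = (1 - fps_X) * parts_fps {1..}"
    using parts_fps_atLeast_Suc[of 1] by (simp add: eval_nat_numeral)
  then show ?thesis
    using card_parts_in_count_less[of 2 "{2..}" n 2] by (simp add: few_twos_def mult_ac)
qed

lemma few_twos_nonempty: "M \<in> few_twos n \<Longrightarrow> 0 < n \<Longrightarrow> M \<noteq> {#}"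
  by (auto simp: few_twos_def parts_in_def partitions_def)

text \<open>
  Decrementing a largest part that occurs only once fails to stay inside \<^const>\<open>few_twos\<close>
  only for the partitions 2 and 3 + 2.
\<close>

lemma card_few_twos_Max_once:
  assumes "6 \<le> n"
  shows "card {M \<in> few_twos n. count M (Max (set_mset M)) = 1} = card (few_twos (n - 1))"
proof -
  let ?up = "\<lambda>M. add_mset (Suc (Max (set_mset M))) (M - {#Max (set_mset M)#})"
  let ?down = "\<lambda>M. add_mset (Max (set_mset M) - 1) (M - {#Max (set_mset M)#})"
  have "bij_betw ?up (few_twos (n - 1)) {M \<in> few_twos n. count M (Max (set_mset M)) = 1}"
  proof (rule bij_betw_byWitness[where f' = ?down])
    have up: "?down (?up M) = M \<and> ?up M \<in> few_twos n \<and> count (?up M) (Max (set_mset (?up M))) = 1"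
      if M: "M \<in> few_twos (n - 1)" for M
    proof -
      have "M \<noteq> {#}"
        using M assms few_twos_nonempty by fastforce
      define a where "a = Max (set_mset M)"
      have a: "a \<in># M"
        using \<open>M \<noteq> {#}\<close> by (simp add: a_def)
      then obtain L where L: "M = add_mset a L"
        by (metis insert_DiffM)
      have le: "x \<le> a" if "x \<in># L" for x
      proof -
        have "x \<in># M"
          using that L by simp
        then show ?thesis
          by (simp add: a_def)
      qed
      have max: "Max (set_mset (add_mset (Suc a) L)) = Suc a"
        using le by (intro Max_eqI) (auto intro: le_SucI)
      \<comment> \<open>The incremented part exceeds all others, so it is the new maximum and occurs
        once, even if \<open>a\<close> was repeated.\<close>
      have "count L (Suc a) = 0"
        using le by (metis Suc_n_not_le_n not_in_iff)
      moreover have "?up M = add_mset (Suc a) L"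
        unfolding a_def[symmetric] using L by simp
      moreover have "add_mset (Suc a) L \<in> few_twos n"
        using M L assms
        by (auto simp: few_twos_def parts_in_def partitions_def split: if_splits)
      ultimately show ?thesis
        using max L by simp
    qed
    have down: "?up (?down M) = M \<and> ?down M \<in> few_twos (n - 1)"
      if M: "M \<in> few_twos n" and once: "count M (Max (set_mset M)) = 1" for M
    proof -
      define a where "a = Max (set_mset M)"
      have a: "a \<in># M"
        using once by (metis a_def count_eq_zero_iff zero_neq_one)
      then obtain L where L: "M = add_mset a L"
        by (metis insert_DiffM)
      have "a \<notin># L"
        using once L unfolding a_def[symmetric] by (simp add: not_in_iff)
      then have less: "x < a" if "x \<in># L" for x
        using that L Max_ge[of "set_mset M" x] by (metis a_def finite_set_mset
            insert_iff le_neq_implies_less set_mset_add_mset_insert)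
      have ge: "x \<ge> 2" if "x \<in># M" for x
        using M that by (auto simp: few_twos_def parts_in_def)
      have sum: "sum_mset M = n"
        using M by (auto simp: few_twos_def parts_in_def partitions_def)
      \<comment> \<open>This makes the decremented part at least 3, so that no further 2 appears.
        Otherwise the parts other than \<open>a\<close> are at most a single 2, and the total is at
        most 3 + 2, contradicting \<open>n >= 6\<close>.\<close>
      have "4 \<le> a"
      proof (rule ccontr)
        assume "\<not> 4 \<le> a"
        have "x = 2" if "x \<in># L" for x
          using less[OF that] ge[of x] that L \<open>\<not> 4 \<le> a\<close> by simp
        then have "set_mset L \<subseteq> {2}"
          by blast
        then obtain m where m: "L = replicate_mset m 2"
          by (rule that[OF set_mset_subset_singletonD])
        moreover have "count L 2 < 2"
          using M L by (auto simp: few_twos_def split: if_splits)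
        ultimately show False
          using sum L assms \<open>\<not> 4 \<le> a\<close> by simp
      qed
      \<comment> \<open>The other parts are below \<open>a\<close>, hence at most
        \<open>a - 1\<close>: the decremented part is still a maximum, possibly a repeated
        one.\<close>
      have max: "Max (set_mset (add_mset (a - 1) L)) = a - 1"
        using less by (intro Max_eqI) fastforce+
      have down_eq: "?down M = add_mset (a - 1) L"
        unfolding a_def[symmetric] using L by simp
      have "add_mset (a - 1) L \<in> few_twos (n - 1)"
        using M L assms \<open>4 \<le> a\<close>
        by (auto simp: few_twos_def parts_in_def partitions_def split: if_splits)
      then show ?thesis
        unfolding down_eq max using \<open>4 \<le> a\<close> L by simp
    qed
    show "\<forall>M\<in>few_twos (n - 1). ?down (?up M) = M"
      using up by blast
    show "\<forall>M\<in>{M \<in> few_twos n. count M (Max (set_mset M)) = 1}. ?up (?down M) = M"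
      using down by blast
    show "?up ` few_twos (n - 1) \<subseteq> {M \<in> few_twos n. count M (Max (set_mset M)) = 1}"
      using up by blast
    show "?down ` {M \<in> few_twos n. count M (Max (set_mset M)) = 1} \<subseteq> few_twos (n - 1)"
      using down by blast
  qed
  then show ?thesis
    by (simp add: bij_betw_same_card)
qed

section \<open>The repeated largest part and the second differences as coefficients\<close>

lemma backward_difference_2:
  "backward_difference 2 f x = f x - 2 * f (x - 1) + f (x - 2)"
  by (simp add: backward_difference_def eval_nat_numeral)

text \<open>Those whose largest part occurs once are as many as all of
  \<open>few_twos (n - 1)\<close>, so removing them multiplies the generating function by a further
  1 - X.\<close>

lemma card_few_twos_Max_repeated:
  assumes "6 \<le> n"
  shows "int (card {M \<in> few_twos n. 1 < count M (Max (set_mset M))}) =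
    ((1 - fps_X)\<^sup>2 * (1 - fps_X ^ 4) * parts_fps {1..}) $ n"
proof -
  let ?R = "{M \<in> few_twos n. 1 < count M (Max (set_mset M))}"
  let ?O = "{M \<in> few_twos n. count M (Max (set_mset M)) = 1}"
  let ?Q = "(1 - fps_X) * (1 - fps_X ^ 4) * parts_fps {1..}"
  have fin: "finite (few_twos n)"
    by (simp add: few_twos_def)
  \<comment> \<open>Non-emptiness matters here: only then is \<open>Max\<close> an actual part, with
    positive multiplicity.\<close>
  have "1 < count M (Max (set_mset M)) \<or> count M (Max (set_mset M)) = 1"
    if "M \<in> few_twos n" for M
  proof -
    have "Max (set_mset M) \<in># M"
      using few_twos_nonempty[OF that] assms by simp
    then show ?thesis
      by (simp only: flip: count_greater_zero_iff) linarith
  qed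
  then have "few_twos n = ?R \<union> ?O"
    by blast
  then have "card (few_twos n) = card (?R \<union> ?O)"
    by simp
  also have "\<dots> = card ?R + card ?O"
    using fin by (intro card_Un_disjoint) auto
  finally have "int (card ?R) = ?Q $ n - ?Q $ (n - 1)"
    using card_few_twos[of n] card_few_twos[of "n - 1"] card_few_twos_Max_once[OF assms] by simp
  also have "\<dots> = ((1 - fps_X) * ?Q) $ n"
    using assms by (simp add: left_diff_distrib del: mult.assoc)
  finally show ?thesis
    by (simp add: power2_eq_square mult.assoc)
qed

lemma backward_difference_2_partition_count:
  assumes "6 \<le> n"
  shows "backward_difference 2 (\<lambda>m. int (partition_count m)) n
      - backward_difference 2 (\<lambda>m. int (partition_count m)) (n - 4) =
    ((1 - fps_X)\<^sup>2 * (1 - fps_X ^ 4) * parts_fps {1..}) $ n"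
proof -
  let ?P = "parts_fps {1..}"
  \<comment> \<open>The first three terms give the second difference at \<open>n\<close>, the other
    three the one at \<open>n - 4\<close>.\<close>
  have "(1 - fps_X)\<^sup>2 * (1 - fps_X ^ 4) * ?P =
      ?P - 2 * (fps_X ^ 1 * ?P) + fps_X ^ 2 * ?P
      - (fps_X ^ 4 * ?P - 2 * (fps_X ^ 5 * ?P) + fps_X ^ 6 * ?P)"
    by algebra
  moreover have "(2 * f) $ n = 2 * (f $ n)" for f :: "int fps"
    unfolding mult_2 by (rule fps_add_nth)
  \<comment> \<open>The largest shift is 6, so \<open>n >= 6\<close> rules out truncation in every
    argument and makes every shifted coefficient a value of the partition function.\<close>
  ultimately show ?thesis
    using assms
    by (simp add: backward_difference_2 partition_count_eq_parts_fps fps_X_power_mult_nth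
        del: power_one_right)
qed

theorem corollary1p7:
  fixes n :: nat
  assumes "n \<ge> 6"
  shows "int (card {M \<in> partitions n.
             1 \<notin># M \<and> count M 2 \<le> 1 \<and> count M (Max (set_mset M)) > 1})
           = backward_difference 2 (\<lambda>m. int (partition_count m)) n
             - backward_difference 2 (\<lambda>m. int (partition_count m)) (n - 4)
       \<and> backward_difference 2 (\<lambda>m. int (partition_count m)) n
             - backward_difference 2 (\<lambda>m. int (partition_count m)) (n - 4)
           = - (\<Sum>k = 5..n + 5. int (part_occurrences 5 (n + 5) k) * moebius k)"
proof
  have "{M \<in> partitions n. 1 \<notin># M \<and> count M 2 \<le> 1 \<and> count M (Max (set_mset M)) > 1} =
      {M \<in> few_twos n. 1 < count M (Max (set_mset M))}"
    by (auto simp: few_twos_eq)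
  then show "int (card {M \<in> partitions n.
             1 \<notin># M \<and> count M 2 \<le> 1 \<and> count M (Max (set_mset M)) > 1})
           = backward_difference 2 (\<lambda>m. int (partition_count m)) n
             - backward_difference 2 (\<lambda>m. int (partition_count m)) (n - 4)"
    using card_few_twos_Max_repeated[OF assms] backward_difference_2_partition_count[OF assms]
    by simp
next
  have "- (\<Sum>k = 5..n + 5. int (part_occurrences 5 (n + 5) k) * moebius k) =
      (fps_X ^ 5 * ((1 - fps_X)\<^sup>2 * (1 - fps_X ^ 4) * parts_fps {1..})) $ (n + 5)"
    unfolding sum_part_occurrences_moebius multiples_fps_mult_parts_fps_5 by simp
  also have "\<dots> = ((1 - fps_X)\<^sup>2 * (1 - fps_X ^ 4) * parts_fps {1..}) $ n"
    unfolding fps_X_power_mult_nth by simp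
  finally show "backward_difference 2 (\<lambda>m. int (partition_count m)) n
             - backward_difference 2 (\<lambda>m. int (partition_count m)) (n - 4)
           = - (\<Sum>k = 5..n + 5. int (part_occurrences 5 (n + 5) k) * moebius k)"
    using backward_difference_2_partition_count[OF assms] by simp
qed

end
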